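(* Let $\mathcal{A}$ be a central hyperplane arrangement in $\mathbb{R}^r$ with coordinates $x_1,\ldots,x_r$ that contains all the coordinate hyperplanes $x_i=0$ ($1\le i\le r$), and suppose that every other hyperplane of $\mathcal{A}$ has a defining form supported on exactly two coordinates, $$\alpha_e=a_e x_{i(e)}+b_e x_{j(e)},\qquad i(e)\neq j(e),\quad a_e,b_e\in\mathbb{R},\quad a_eb_e\neq 0 .$$ Let $\mathcal{A}^\kappa$ be the Cremona transform of $\mathcal{A}$, i.e. the arrangement in $\mathbb{R}^r$ with coordinates $X_1,\ldots,X_r$ consisting of all coordinate hyperplanes $X_i=0$ together with, for each non-coordinate hyperplane of $\mathcal{A}$ with defining form $\alpha_e=a_e x_{i(e)}+b_e x_{j(e)}$, the hyperplane $\beta_e=0$ with $$\beta_e=b_eX_{i(e)}+a_eX_{j(e)} .$$ Then for every commutative ring $R$, coordinatewise inversion $$\kappa(x_1,\ldots,x_r)=(X_1,\ldots,X_r)=(x_1^{-1},\ldots,x_r^{-1})$$ induces an isomorphism of filtered $R$-algebras $$\kappa^*:\mathrm{VG}(\mathcal{A}^\kappa)_R\xrightarrow{\ \cong\ }\mathrm{VG}(\mathcal{A})_R .$$ Equivalently, $\kappa^*$ is a well-defined isomorphism of $R$-algebras and $\kappa^*F^p\mathrm{VG}(\mathcal{A}^\kappa)_R=F^p\mathrm{VG}(\mathcal{A})_R$ for every $p\ge 0$.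
   Context: A central hyperplane arrangement $\mathcal{A}=\{H_1,\ldots,H_n\}$ in a real vector space $V$ is a finite set of linear hyperplanes. Each $H_i$ is the kernel of a chosen nonzero linear form $\alpha_i$ (a defining form). The complement is $M(\mathcal{A})=V\setminus\bigcup_{i}H_i$; its connected components are called chambers, and $\mathrm{Ch}(\mathcal{A})$ denotes the set of chambers. For a commutative ring $R$, the Varchenko--Gelfand algebra is $\mathrm{VG}(\mathcal{A})_R=R^{\mathrm{Ch}(\mathcal{A})}$, the $R$-algebra of all functions $\mathrm{Ch}(\mathcal{A})\to R$ with pointwise addition and multiplication. For a defining form $\alpha_i$, the Heaviside function $h_{\alpha_i}\in\mathrm{VG}(\mathcal{A})_R$ takes the value $1$ on a chamber $C$ if $\alpha_i>0$ on $C$, and $0$ if $\alpha_i<0$ on $C$. For $p\ge 0$, $F^p\mathrm{VG}(\mathcal{A})_R$ is the $R$-linear span of all products of at most $p$ Heaviside functions (the empty product being $1$). This filtration does not depend on the choice of defining forms, since $h_{-\alpha_i}=1-h_{\alpha_i}$. An isomorphism of filtered $R$-algebras is an $R$-algebra isomorphism carrying the $p$-th filtered piece onto the $p$-th filtered piece for every $p\ge 0$. The map $\kappa$ is defined on the torus $(\mathbb{R}\setminus\{0\})^r$, which contains both $M(\mathcal{A})$ and $M(\mathcal{A}^\kappa)$. The map $\kappa^*$ is pullback of functions: $(\kappa^*f)(C)=f(\kappa(C))$ for $f\in\mathrm{VG}(\mathcal{A}^\kappa)_R$ and $C\in\mathrm{Ch}(\mathcal{A})$; that $\kappa$ induces a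 bijection $\mathrm{Ch}(\mathcal{A})\to\mathrm{Ch}(\mathcal{A}^\kappa)$, $C\mapsto\kappa(C)$, is part of the assertion that $\kappa$ induces such an isomorphism. *)

theory Defs
  imports "HOL-Analysis.Analysis" "HOL-Algebra.Module" "HOL-Algebra.QuotRing"
begin

definition defining_form :: "('v::euclidean_space \<Rightarrow> real) \<Rightarrow> 'v set \<Rightarrow> bool" where
  "defining_form \<alpha> H \<longleftrightarrow> linear \<alpha> \<and> (\<exists>x. \<alpha> x \<noteq> 0) \<and> H = {x. \<alpha> x = 0}"

definition central_arrangement :: "'v::euclidean_space set set \<Rightarrow> bool" where
  "central_arrangement A \<longleftrightarrow> finite A \<and> (\<forall>H\<in>A. \<exists>\<alpha>. defining_form \<alpha> H)"

text \<open>A choice of one defining form for every hyperplane of the arrangement.\<close>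

definition defining_forms ::
    "'v::euclidean_space set set \<Rightarrow> ('v set \<Rightarrow> 'v \<Rightarrow> real) \<Rightarrow> bool" where
  "defining_forms A \<alpha> \<longleftrightarrow> (\<forall>H\<in>A. defining_form (\<alpha> H) H)"

definition arr_complement :: "'v::euclidean_space set set \<Rightarrow> 'v set" where
  "arr_complement A = UNIV - \<Union>A"

definition chambers :: "'v::euclidean_space set set \<Rightarrow> 'v set set" where
  "chambers A = components (arr_complement A)"

text \<open>Functions on the set of chambers are represented as extensional functions, so that equality
  in the carrier is equality of functions on the chambers.\<close>

definition VG ::
    "('r, 'm) ring_scheme \<Rightarrow> 'v::euclidean_space set set \<Rightarrow> ('r, 'v set \<Rightarrow> 'r) module" where
  "VG R A =
    \<lparr>carrier = chambers A \<rightarrow>\<^sub>E carrier R,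
     mult = (\<lambda>f g. \<lambda>C\<in>chambers A. f C \<otimes>\<^bsub>R\<^esub> g C),
     one = (\<lambda>C\<in>chambers A. \<one>\<^bsub>R\<^esub>),
     zero = (\<lambda>C\<in>chambers A. \<zero>\<^bsub>R\<^esub>),
     add = (\<lambda>f g. \<lambda>C\<in>chambers A. f C \<oplus>\<^bsub>R\<^esub> g C),
     smult = (\<lambda>r f. \<lambda>C\<in>chambers A. r \<otimes>\<^bsub>R\<^esub> f C)\<rparr>"

text \<open>If \<open>\<alpha>\<close> defines a hyperplane of \<open>A\<close>, it has constant sign on every chamber
  (lemma \<open>chamber_sign\<close> below), so the value \<open>\<zero>\<close> is taken exactly on the chambers
  where \<open>\<alpha> < 0\<close>.\<close>

definition heaviside ::
    "('r, 'm) ring_scheme \<Rightarrow> 'v::euclidean_space set set \<Rightarrow> ('v \<Rightarrow> real) \<Rightarrow> 'v set \<Rightarrow> 'r" where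
  "heaviside R A \<alpha> = (\<lambda>C\<in>chambers A. if \<forall>x\<in>C. \<alpha> x > 0 then \<one>\<^bsub>R\<^esub> else \<zero>\<^bsub>R\<^esub>)"

definition lin_span :: "('r, 'm) ring_scheme \<Rightarrow> ('r, 'a, 'k) module_scheme \<Rightarrow> 'a set \<Rightarrow> 'a set" where
  "lin_span R M S =
    {(\<Oplus>\<^bsub>M\<^esub>s\<in>T. c s \<odot>\<^bsub>M\<^esub> s) | T c. finite T \<and> T \<subseteq> S \<and> c \<in> T \<rightarrow> carrier R}"

definition VG_filt ::
    "('r, 'm) ring_scheme \<Rightarrow> 'v::euclidean_space set set \<Rightarrow> ('v set \<Rightarrow> 'v \<Rightarrow> real) \<Rightarrow> nat
      \<Rightarrow> ('v set \<Rightarrow> 'r) set" where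
  "VG_filt R A \<alpha> p = lin_span R (VG R A)
    {(\<Otimes>\<^bsub>VG R A\<^esub>i\<in>{..<k}. heaviside R A (\<alpha> (H i))) | k H. k \<le> p \<and> H \<in> {..<k} \<rightarrow> A}"

definition alg_iso ::
    "('r, 'm) ring_scheme \<Rightarrow> ('r, 'a, 'k) module_scheme \<Rightarrow> ('r, 'b, 'l) module_scheme
      \<Rightarrow> ('a \<Rightarrow> 'b) set" where
  "alg_iso R M N =
    {\<phi> \<in> ring_iso M N. \<forall>r\<in>carrier R. \<forall>f\<in>carrier M. \<phi> (r \<odot>\<^bsub>M\<^esub> f) = r \<odot>\<^bsub>N\<^esub> \<phi> f}"

definition filtered_alg_iso ::
    "('r, 'm) ring_scheme \<Rightarrow> ('r, 'a, 'k) module_scheme \<Rightarrow> (nat \<Rightarrow> 'a set)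
      \<Rightarrow> ('r, 'b, 'l) module_scheme \<Rightarrow> (nat \<Rightarrow> 'b set) \<Rightarrow> ('a \<Rightarrow> 'b) set" where
  "filtered_alg_iso R M FM N FN = {\<phi> \<in> alg_iso R M N. \<forall>p. \<phi> ` FM p = FN p}"

definition coord_hyperplane :: "'n::finite \<Rightarrow> (real^'n) set" where
  "coord_hyperplane i = {x. x $ i = 0}"

definition two_term_form :: "real \<Rightarrow> 'n::finite \<Rightarrow> real \<Rightarrow> 'n \<Rightarrow> real^'n \<Rightarrow> real" where
  "two_term_form a i b j x = a * x $ i + b * x $ j"

text \<open>The two-term form defining a given hyperplane is unique up to a nonzero scalar and up to
  interchanging the two summands, and neither changes the kernel of the transformed form; hence
  every non-coordinate hyperplane contributes exactly one hyperplane below.\<close>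

definition cremona :: "(real^'n::finite) set set \<Rightarrow> (real^'n) set set" where
  "cremona A = range coord_hyperplane \<union>
    {{X. two_term_form b i a j X = 0} | a i b j.
       i \<noteq> j \<and> a \<noteq> 0 \<and> b \<noteq> 0 \<and> {x. two_term_form a i b j x = 0} \<in> A}"

text \<open>Only the values of \<open>\<kappa>\<close> on the torus (all coordinates nonzero) are meaningful.\<close>

definition kappa :: "real^'n::finite \<Rightarrow> real^'n" where
  "kappa x = (\<chi> i. inverse (x $ i))"

definition kappa_pullback ::
    "(real^'n::finite) set set \<Rightarrow> ((real^'n) set \<Rightarrow> 'r) \<Rightarrow> (real^'n) set \<Rightarrow> 'r" where
  "kappa_pullback A f = (\<lambda>C\<in>chambers A. f (kappa ` C))"


lemma chamber_sign:
  assumes "defining_form \<alpha> H" "H \<in> A" "C \<in> chambers A"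
  shows "(\<forall>x\<in>C. \<alpha> x > 0) \<noteq> (\<forall>x\<in>C. \<alpha> x < 0)"
proof -
  have C: "connected C" "C \<noteq> {}" "C \<subseteq> arr_complement A"
    using assms(3)[unfolded chambers_def]
    by (rule in_components_connected in_components_nonempty in_components_subset)+
  have nz: "\<alpha> x \<noteq> 0" if "x \<in> C" for x
    using that C(3) assms(1,2) by (auto simp: arr_complement_def defining_form_def)
  have "continuous_on C \<alpha>"
    using assms(1) by (simp add: defining_form_def linear_continuous_on linear_conv_bounded_linear)
  then have "connected (\<alpha> ` C)"
    using C(1) connected_continuous_image by blast
  then have no: False if "x \<in> C" "y \<in> C" "\<alpha> x < 0" "\<alpha> y > 0" for x y
    using connectedD_interval[of "\<alpha> ` C" "\<alpha> x" "\<alpha> y" 0] that nz by auto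
  obtain x where x: "x \<in> C" using C(2) by blast
  show ?thesis
  proof (cases "\<alpha> x > 0")
    case True
    have "\<alpha> y > 0" if "y \<in> C" for y
      using no[OF that x _ True] nz[OF that] by (cases "\<alpha> y < 0") auto
    moreover have "\<not> \<alpha> x < 0" using True by simp
    ultimately show ?thesis using x by blast
  next
    case False
    then have neg: "\<alpha> x < 0" using nz[OF x] by linarith
    have "\<alpha> y < 0" if "y \<in> C" for y
      using no[OF x that neg] nz[OF that] by (cases "\<alpha> y > 0") auto
    with False show ?thesis using x by blast
  qed
qed

lemma VG_algebra:
  fixes R (structure)
  assumes "cring R"
  shows "Module.algebra R (VG R A)"
proof -
  interpret cring R by fact
  have eqI: "f = g"
    if "f \<in> carrier (VG R A)" "g \<in> carrier (VG R A)" "\<And>C. C \<in> chambers A \<Longrightarrow> f C = g C" for f g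
    using that by (auto simp: VG_def intro: PiE_ext)
  have val: "f C \<in> carrier R" if "f \<in> carrier (VG R A)" "C \<in> chambers A" for f C
    using that by (auto simp: VG_def)
  have closed:
      "\<zero>\<^bsub>VG R A\<^esub> \<in> carrier (VG R A)" "\<one>\<^bsub>VG R A\<^esub> \<in> carrier (VG R A)"
      "\<And>f g. \<lbrakk>f \<in> carrier (VG R A); g \<in> carrier (VG R A)\<rbrakk> \<Longrightarrow> f \<oplus>\<^bsub>VG R A\<^esub> g \<in> carrier (VG R A)"
      "\<And>f g. \<lbrakk>f \<in> carrier (VG R A); g \<in> carrier (VG R A)\<rbrakk> \<Longrightarrow> f \<otimes>\<^bsub>VG R A\<^esub> g \<in> carrier (VG R A)"
      "\<And>r f. \<lbrakk>r \<in> carrier R; f \<in> carrier (VG R A)\<rbrakk> \<Longrightarrow> r \<odot>\<^bsub>VG R A\<^esub> f \<in> carrier (VG R A)"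
    by (auto simp: VG_def PiE_iff)
  have app:
      "\<zero>\<^bsub>VG R A\<^esub> C = \<zero>" "\<one>\<^bsub>VG R A\<^esub> C = \<one>" "(f \<oplus>\<^bsub>VG R A\<^esub> g) C = f C \<oplus> g C"
      "(f \<otimes>\<^bsub>VG R A\<^esub> g) C = f C \<otimes> g C" "(r \<odot>\<^bsub>VG R A\<^esub> f) C = r \<otimes> f C"
    if "C \<in> chambers A" for C f g r
    using that by (auto simp: VG_def)
  show ?thesis
  proof (rule Module.algebraI)
    show "cring (VG R A)"
    proof (rule cringI)
      show "abelian_group (VG R A)"
      proof (rule abelian_groupI)
        fix f assume f: "f \<in> carrier (VG R A)"
        have g: "(\<lambda>C\<in>chambers A. \<ominus> f C) \<in> carrier (VG R A)"
          using f by (auto simp: VG_def PiE_iff)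
        have "(\<lambda>C\<in>chambers A. \<ominus> f C) \<oplus>\<^bsub>VG R A\<^esub> f = \<zero>\<^bsub>VG R A\<^esub>"
          by (rule eqI) (simp_all add: f g closed app val l_neg)
        with g show "\<exists>g\<in>carrier (VG R A). g \<oplus>\<^bsub>VG R A\<^esub> f = \<zero>\<^bsub>VG R A\<^esub>" by blast
      qed (auto intro!: eqI closed simp: app val a_ac)
      show "comm_monoid (VG R A)"
        by (rule comm_monoidI) (auto intro!: eqI closed simp: app val m_ac)
    qed (auto intro!: eqI closed simp: app val l_distr)
  qed (use assms in \<open>auto intro!: eqI closed simp: app val l_distr r_distr m_assoc\<close>)
qed

lemma defining_form_two_term:
  assumes "i \<noteq> j" "a \<noteq> 0"
  shows "defining_form (two_term_form a i b j) {x. two_term_form a i b j x = 0}"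
proof -
  have "linear (two_term_form a i b j)"
    by (rule linearI) (auto simp: two_term_form_def algebra_simps)
  moreover have "two_term_form a i b j (axis i 1) \<noteq> 0"
    using assms by (simp add: two_term_form_def axis_def)
  ultimately show ?thesis by (auto simp: defining_form_def)
qed

lemma defining_form_coord:
  fixes i :: "'n::finite"
  shows "defining_form (\<lambda>x::real^'n. x $ i) (coord_hyperplane i)"
proof -
  have "linear (\<lambda>x::real^'n. x $ i)" by (rule linearI) auto
  moreover have "(axis i 1 :: real^'n) $ i \<noteq> 0" by (simp add: axis_def)
  ultimately show ?thesis unfolding defining_form_def coord_hyperplane_def by blast
qed

lemma central_arrangement_cremona:
  fixes A :: "(real^'n::finite) set set"
  assumes "central_arrangement A"
  shows "central_arrangement (cremona A)"
proof -
  define s :: "'n \<Rightarrow> 'n \<Rightarrow> real^'n \<Rightarrow> real^'n"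
    where "s i j x = (\<chi> k. x $ (if k = i then j else if k = j then i else k))" for i j x
  let ?B = "range coord_hyperplane \<union> (\<Union>i. \<Union>j. (\<lambda>H. s i j -` H) ` A)"
  have cases: thesis
    if "H \<in> cremona A"
      and "\<And>i. H = coord_hyperplane i \<Longrightarrow> thesis"
      and "\<And>a i b j. \<lbrakk>H = {X. two_term_form b i a j X = 0}; i \<noteq> j; b \<noteq> 0;
             {x. two_term_form a i b j x = 0} \<in> A\<rbrakk> \<Longrightarrow> thesis" for H thesis
    using that unfolding cremona_def by blast
  have "H \<in> ?B" if "H \<in> cremona A" for H
    using that
  proof (rule cases)
    fix a i b j
    assume H: "H = {X. two_term_form b i a j X = 0}" "i \<noteq> j"
      and A: "{x. two_term_form a i b j x = 0} \<in> A"
    have "two_term_form a i b j (s i j X) = two_term_form b i a j X" for X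
      using \<open>i \<noteq> j\<close> by (simp add: s_def two_term_form_def)
    then have "H = s i j -` {x. two_term_form a i b j x = 0}"
      using H(1) by simp
    with A show "H \<in> ?B" by blast
  qed simp
  moreover have "finite ?B"
    using assms by (simp add: central_arrangement_def)
  ultimately have "finite (cremona A)" by (meson finite_subset subsetI)
  moreover have "\<exists>\<alpha>. defining_form \<alpha> H" if "H \<in> cremona A" for H
    using that
  proof (rule cases)
    show "\<exists>\<alpha>. defining_form \<alpha> H" if "H = coord_hyperplane i" for i
      unfolding that by (rule exI, rule defining_form_coord)
    show "\<exists>\<alpha>. defining_form \<alpha> H"
      if "H = {X. two_term_form b i a j X = 0}" "i \<noteq> j" "b \<noteq> 0" for a i b j
      unfolding that(1) by (rule exI, rule defining_form_two_term[OF that(2,3)])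
  qed
  ultimately show ?thesis by (simp add: central_arrangement_def)
qed

end

theory Submission
  imports Defs
begin

text \<open>On the torus a two-term form transforms by
  \<open>b / x\<^sub>i + a / x\<^sub>j = (a x\<^sub>i + b x\<^sub>j) / (x\<^sub>i x\<^sub>j)\<close>, so coordinatewise inversion
  carries the complement of the arrangement into the complement of its Cremona transform. The same
  holds in the other direction, and inversion is an involution; hence it is a homeomorphism of
  the complements and matches up their chambers (\<open>homeomorphism_kappa\<close>,
  \<open>bij_betw_chambers\<close>). Pullback is then an isomorphism of function algebras, and what
  remains is the filtration.

  The sign of the transformed form is the product of the signs of \<open>a x\<^sub>i + b x\<^sub>j\<close>,
  \<open>x\<^sub>i\<close> and \<open>x\<^sub>j\<close>, which suggests that its Heaviside function has filtration degree
  three. The degree is nevertheless one, because the three forms are linearly dependent: if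
  \<open>u\<close>, \<open>v\<close> and \<open>u + v\<close> are nonzero reals, only six of the eight sign patterns occur, and
  on these, writing \<open>[P]\<close> for 1 if \<open>P\<close> holds and 0 otherwise,
  \<open>[1/u + 1/v > 0] = [u > 0] + [v > 0] - [u + v > 0]\<close>.
  Taking for \<open>u\<close> and \<open>v\<close> suitable multiples of \<open>x\<^sub>i\<close> and \<open>x\<^sub>j\<close>, this expresses the
  pullback of every Heaviside function as an integral combination of Heaviside functions
  (\<open>kappa_pullback_heaviside_in_F1\<close>). Since pullback is multiplicative and the filtration
  is multiplicative with respect to its first piece (\<open>F_times_F1\<close>), pullback maps each filtered
  piece into the corresponding one. The relation between the two arrangements is symmetric,
  so the inverse pullback does the same, and the inclusions are equalities
  (\<open>kappa_pullback_filt\<close>).\<close>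

section \<open>Linear spans in a module\<close>

lemma (in module) lin_span_base:
  assumes "S \<subseteq> carrier M" "s \<in> S"
  shows "s \<in> lin_span R M S"
proof -
  have "s \<in> carrier M" using assms by auto
  then have "s = (\<Oplus>\<^bsub>M\<^esub>t\<in>{s}. \<one> \<odot>\<^bsub>M\<^esub> t)" by simp
  then show ?thesis
    unfolding lin_span_def using assms(2) by (intro CollectI exI[of _ "{s}"] exI[of _ "\<lambda>_. \<one>"]) auto
qed

lemma (in module) lin_span_zero: "\<zero>\<^bsub>M\<^esub> \<in> lin_span R M S"
  unfolding lin_span_def by (intro CollectI exI[of _ "{}"] exI[of _ "\<lambda>_. \<zero>"]) auto

lemma (in module) lin_span_subset_carrier:
  assumes "S \<subseteq> carrier M"
  shows "lin_span R M S \<subseteq> carrier M"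
  using assms by (fastforce simp: lin_span_def intro!: M.finsum_closed)

lemma (in module) lin_span_add:
  assumes S: "S \<subseteq> carrier M" and "x \<in> lin_span R M S" "y \<in> lin_span R M S"
  shows "x \<oplus>\<^bsub>M\<^esub> y \<in> lin_span R M S"
proof -
  obtain T c where T: "finite T" "T \<subseteq> S" "c \<in> T \<rightarrow> carrier R"
    and x: "x = (\<Oplus>\<^bsub>M\<^esub>s\<in>T. c s \<odot>\<^bsub>M\<^esub> s)"
    using assms(2) by (auto simp: lin_span_def)
  obtain U d where U: "finite U" "U \<subseteq> S" "d \<in> U \<rightarrow> carrier R"
    and y: "y = (\<Oplus>\<^bsub>M\<^esub>s\<in>U. d s \<odot>\<^bsub>M\<^esub> s)"
    using assms(3) by (auto simp: lin_span_def)
  \<comment> \<open>Extending both coefficient functions by zero puts the two sums over a common index set.\<close>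
  let ?c = "\<lambda>s. if s \<in> T then c s else \<zero>" and ?d = "\<lambda>s. if s \<in> U then d s else \<zero>"
  have M: "s \<in> carrier M" if "s \<in> T \<union> U" for s using that S T(2) U(2) by auto
  have c: "?c s \<in> carrier R" and d: "?d s \<in> carrier R" for s using T(3) U(3) by auto
  have cM: "s \<in> T \<Longrightarrow> c s \<odot>\<^bsub>M\<^esub> s \<in> carrier M" and dM: "s \<in> U \<Longrightarrow> d s \<odot>\<^bsub>M\<^esub> s \<in> carrier M" for s
    using M T(3) U(3) by auto
  have "x = (\<Oplus>\<^bsub>M\<^esub>s\<in>T \<union> U. ?c s \<odot>\<^bsub>M\<^esub> s)"
    unfolding x using T(1) U(1) M cM by (intro M.add.finprod_mono_neutral_cong_left) auto
  moreover have "y = (\<Oplus>\<^bsub>M\<^esub>s\<in>T \<union> U. ?d s \<odot>\<^bsub>M\<^esub> s)"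
    unfolding y using T(1) U(1) M dM by (intro M.add.finprod_mono_neutral_cong_left) auto
  moreover have "(\<Oplus>\<^bsub>M\<^esub>s\<in>T \<union> U. ?c s \<odot>\<^bsub>M\<^esub> s) \<oplus>\<^bsub>M\<^esub> (\<Oplus>\<^bsub>M\<^esub>s\<in>T \<union> U. ?d s \<odot>\<^bsub>M\<^esub> s)
      = (\<Oplus>\<^bsub>M\<^esub>s\<in>T \<union> U. ?c s \<odot>\<^bsub>M\<^esub> s \<oplus>\<^bsub>M\<^esub> ?d s \<odot>\<^bsub>M\<^esub> s)"
    using M c d by (intro M.finsum_addf[symmetric] Pi_I smult_closed) blast+
  moreover have "\<dots> = (\<Oplus>\<^bsub>M\<^esub>s\<in>T \<union> U. (?c s \<oplus> ?d s) \<odot>\<^bsub>M\<^esub> s)"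
  proof (rule M.finsum_cong')
    show "(\<lambda>s. (?c s \<oplus> ?d s) \<odot>\<^bsub>M\<^esub> s) \<in> T \<union> U \<rightarrow> carrier M"
      using M c d by (intro Pi_I smult_closed R.add.m_closed) blast+
    show "?c s \<odot>\<^bsub>M\<^esub> s \<oplus>\<^bsub>M\<^esub> ?d s \<odot>\<^bsub>M\<^esub> s = (?c s \<oplus> ?d s) \<odot>\<^bsub>M\<^esub> s" if "s \<in> T \<union> U" for s
      using smult_l_distr[OF c d M[OF that]] by (rule sym)
  qed (rule refl)
  ultimately have "x \<oplus>\<^bsub>M\<^esub> y = (\<Oplus>\<^bsub>M\<^esub>s\<in>T \<union> U. (?c s \<oplus> ?d s) \<odot>\<^bsub>M\<^esub> s)" by simp
  moreover have "finite (T \<union> U)" "T \<union> U \<subseteq> S" using T U by auto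
  moreover have "(\<lambda>s. ?c s \<oplus> ?d s) \<in> T \<union> U \<rightarrow> carrier R"
    by (intro Pi_I R.add.m_closed c d)
  ultimately show ?thesis unfolding lin_span_def
    by (intro CollectI exI[of _ "T \<union> U"] exI[of _ "\<lambda>s. ?c s \<oplus> ?d s"] conjI)
qed

lemma (in module) lin_span_smult:
  assumes S: "S \<subseteq> carrier M" and r: "r \<in> carrier R" and "x \<in> lin_span R M S"
  shows "r \<odot>\<^bsub>M\<^esub> x \<in> lin_span R M S"
proof -
  obtain T c where T: "finite T" "T \<subseteq> S" "c \<in> T \<rightarrow> carrier R"
    and x: "x = (\<Oplus>\<^bsub>M\<^esub>s\<in>T. c s \<odot>\<^bsub>M\<^esub> s)"
    using assms(3) by (auto simp: lin_span_def)
  have M: "s \<in> carrier M" and c: "c s \<in> carrier R" if "s \<in> T" for s using that S T by auto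
  have "r \<odot>\<^bsub>M\<^esub> x = (\<Oplus>\<^bsub>M\<^esub>s\<in>T. r \<odot>\<^bsub>M\<^esub> (c s \<odot>\<^bsub>M\<^esub> s))"
    unfolding x using T M c r by (intro finsum_smult_ldistr) auto
  also have "\<dots> = (\<Oplus>\<^bsub>M\<^esub>s\<in>T. (r \<otimes> c s) \<odot>\<^bsub>M\<^esub> s)"
    using M c r by (intro M.finsum_cong') (auto simp: smult_assoc1)
  finally show ?thesis
    unfolding lin_span_def using T r by (intro CollectI exI[of _ T] exI[of _ "\<lambda>s. r \<otimes> c s"]) auto
qed

text \<open>This replaces computations with sums: that a linear map sends one span into another, or
  that products of elements of two spans lie in a third, follows by applying it to the set of
  elements with the desired property.\<close>

lemma (in module) lin_span_least:
  assumes N: "N \<subseteq> carrier M" "\<zero>\<^bsub>M\<^esub> \<in> N"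
      "\<And>x y. \<lbrakk>x \<in> N; y \<in> N\<rbrakk> \<Longrightarrow> x \<oplus>\<^bsub>M\<^esub> y \<in> N"
      "\<And>r x. \<lbrakk>r \<in> carrier R; x \<in> N\<rbrakk> \<Longrightarrow> r \<odot>\<^bsub>M\<^esub> x \<in> N"
    and "S \<subseteq> N"
  shows "lin_span R M S \<subseteq> N"
proof
  fix x assume "x \<in> lin_span R M S"
  then obtain T c where T: "finite T" "T \<subseteq> S" "c \<in> T \<rightarrow> carrier R"
    and x: "x = (\<Oplus>\<^bsub>M\<^esub>s\<in>T. c s \<odot>\<^bsub>M\<^esub> s)"
    by (auto simp: lin_span_def)
  from T have "(\<Oplus>\<^bsub>M\<^esub>s\<in>T. c s \<odot>\<^bsub>M\<^esub> s) \<in> N"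
  proof (induction T rule: finite_induct)
    case (insert s T)
    have mem: "c t \<odot>\<^bsub>M\<^esub> t \<in> N" if "t \<in> insert s T" for t
      using that insert.prems assms(5) by (intro N(4)) auto
    then have "(\<Oplus>\<^bsub>M\<^esub>t\<in>insert s T. c t \<odot>\<^bsub>M\<^esub> t) = c s \<odot>\<^bsub>M\<^esub> s \<oplus>\<^bsub>M\<^esub> (\<Oplus>\<^bsub>M\<^esub>t\<in>T. c t \<odot>\<^bsub>M\<^esub> t)"
      using insert.hyps N(1) by (intro M.finsum_insert) auto
    with mem insert show ?case by (auto intro!: N(3))
  qed (simp add: N(2))
  with x show "x \<in> N" by simp
qed

lemma (in module) lin_span_mono:
  assumes "S \<subseteq> T" "T \<subseteq> carrier M"
  shows "lin_span R M S \<subseteq> lin_span R M T"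
  using assms
  by (intro lin_span_least lin_span_subset_carrier lin_span_zero lin_span_add lin_span_smult)
    (auto intro: lin_span_base)

section \<open>Heaviside functions and their filtration\<close>

lemma carrier_VG_eqI:
  assumes "f \<in> carrier (VG R A)" "g \<in> carrier (VG R A)" "\<And>C. C \<in> chambers A \<Longrightarrow> f C = g C"
  shows "f = g"
  using assms by (auto simp: VG_def intro: PiE_ext)

lemma heaviside_carrier:
  assumes "cring R"
  shows "heaviside R A \<phi> \<in> carrier (VG R A)"
proof -
  interpret cring R by fact
  show ?thesis by (auto simp: heaviside_def VG_def)
qed

lemma heaviside_at:
  assumes "defining_form \<phi> H" "H \<in> A" "C \<in> chambers A" "x \<in> C"
  shows "heaviside R A \<phi> C = (if \<phi> x > 0 then \<one>\<^bsub>R\<^esub> else \<zero>\<^bsub>R\<^esub>)"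
  using chamber_sign[OF assms(1-3)] assms(3,4) unfolding heaviside_def
  by (auto dest: order.asym)

lemma defining_form_nonzero:
  assumes "defining_form \<phi> H" "H \<in> A" "C \<in> chambers A" "x \<in> C"
  shows "\<phi> x \<noteq> 0"
  using assms in_components_subset[of C "arr_complement A"]
  by (auto simp: defining_form_def chambers_def arr_complement_def)

text \<open>A linear form with kernel \<open>H\<close> is determined by its value at one point \<open>z\<close> off \<open>H\<close>,
  since every vector differs from a multiple of \<open>z\<close> by an element of \<open>H\<close>.\<close>

lemma defining_form_unique_up_to_scalar:
  assumes "defining_form \<phi> H" "defining_form \<psi> H"
  shows "\<exists>c. c \<noteq> 0 \<and> (\<forall>x. \<psi> x = c * \<phi> x)"
proof -
  from assms have lin: "linear \<phi>" "linear \<psi>" and ker: "\<phi> x = 0 \<longleftrightarrow> \<psi> x = 0" for x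
    by (auto simp: defining_form_def)
  from assms(1) obtain z where z: "\<phi> z \<noteq> 0" by (auto simp: defining_form_def)
  show ?thesis
  proof (intro exI conjI allI)
    show "\<psi> z / \<phi> z \<noteq> 0" using z ker by simp
    fix x
    have "\<phi> (x - (\<phi> x / \<phi> z) *\<^sub>R z) = 0"
      using z by (simp add: linear_diff[OF lin(1)] linear_scale[OF lin(1)])
    then have "\<psi> (x - (\<phi> x / \<phi> z) *\<^sub>R z) = 0" using ker by simp
    then show "\<psi> x = \<psi> z / \<phi> z * \<phi> x"
      by (simp add: linear_diff[OF lin(2)] linear_scale[OF lin(2)])
  qed
qed

lemma defining_form_scale:
  assumes "defining_form \<phi> H" "c \<noteq> 0"
  shows "defining_form (\<lambda>x. c * \<phi> x) H"
  using assms linear_compose_scale_right[of \<phi> c] by (auto simp: defining_form_def)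

locale VG_filtered =
  fixes R :: "('r, 'm) ring_scheme" and A :: "'v::euclidean_space set set" and \<alpha>
  assumes cring_R: "cring R" and forms: "defining_forms A \<alpha>"

sublocale VG_filtered \<subseteq> Module.algebra R "VG R A"
  by (rule VG_algebra) (rule cring_R)

context VG_filtered
begin

abbreviation F :: "nat \<Rightarrow> ('v set \<Rightarrow> 'r) set" where "F \<equiv> VG_filt R A \<alpha>"
abbreviation V where "V \<equiv> VG R A"
abbreviation h where "h \<equiv> heaviside R A"

definition heaviside_products :: "nat \<Rightarrow> ('v set \<Rightarrow> 'r) set" where
  "heaviside_products p =
    {(\<Otimes>\<^bsub>V\<^esub>i\<in>{..<k}. h (\<alpha> (H i))) | k H. k \<le> p \<and> H \<in> {..<k} \<rightarrow> A}"

lemma F_eq: "F p = lin_span R V (heaviside_products p)"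
  by (simp add: VG_filt_def heaviside_products_def)

lemma h_carrier: "h \<phi> \<in> carrier V"
  by (rule heaviside_carrier) (rule cring_R)

lemma heaviside_products_carrier: "heaviside_products p \<subseteq> carrier V"
  by (auto simp: heaviside_products_def h_carrier intro!: finprod_closed)

lemma heaviside_products_mono: "p \<le> q \<Longrightarrow> heaviside_products p \<subseteq> heaviside_products q"
  unfolding heaviside_products_def by (blast intro: order_trans)

lemma F_carrier: "F p \<subseteq> carrier V"
  unfolding F_eq by (intro lin_span_subset_carrier heaviside_products_carrier)

lemma F_zero: "\<zero>\<^bsub>V\<^esub> \<in> F p"
  and F_add: "\<lbrakk>f \<in> F p; g \<in> F p\<rbrakk> \<Longrightarrow> f \<oplus>\<^bsub>V\<^esub> g \<in> F p"
  and F_smult: "\<lbrakk>r \<in> carrier R; f \<in> F p\<rbrakk> \<Longrightarrow> r \<odot>\<^bsub>V\<^esub> f \<in> F p"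
  and F_base: "f \<in> heaviside_products p \<Longrightarrow> f \<in> F p"
  unfolding F_eq using heaviside_products_carrier
  by (auto intro: lin_span_zero lin_span_add lin_span_smult lin_span_base)

lemma F_minus:
  assumes "f \<in> F p" "g \<in> F p"
  shows "f \<ominus>\<^bsub>V\<^esub> g \<in> F p"
proof -
  have "g \<in> carrier V" using assms F_carrier by blast
  then have "(\<ominus>\<^bsub>R\<^esub> \<one>\<^bsub>R\<^esub>) \<odot>\<^bsub>V\<^esub> g = \<ominus>\<^bsub>V\<^esub> g" by (simp add: smult_l_minus)
  then show ?thesis
    using F_add[OF assms(1) F_smult[OF _ assms(2), of "\<ominus>\<^bsub>R\<^esub> \<one>\<^bsub>R\<^esub>"]] by (simp add: a_minus_def)
qed

lemma F_mono: "p \<le> q \<Longrightarrow> F p \<subseteq> F q"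
  unfolding F_eq by (intro lin_span_mono heaviside_products_mono heaviside_products_carrier)

lemma heaviside_product_times_heaviside:
  assumes "f \<in> heaviside_products p" "H \<in> A"
  shows "f \<otimes>\<^bsub>V\<^esub> h (\<alpha> H) \<in> heaviside_products (Suc p)"
proof -
  obtain k K where k: "k \<le> p" "K \<in> {..<k} \<rightarrow> A" and f: "f = (\<Otimes>\<^bsub>V\<^esub>i\<in>{..<k}. h (\<alpha> (K i)))"
    using assms(1) by (auto simp: heaviside_products_def)
  let ?K = "K(k := H)"
  have "(\<Otimes>\<^bsub>V\<^esub>i\<in>{..<Suc k}. h (\<alpha> (?K i))) = h (\<alpha> H) \<otimes>\<^bsub>V\<^esub> (\<Otimes>\<^bsub>V\<^esub>i\<in>{..<k}. h (\<alpha> (?K i)))"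
    unfolding lessThan_Suc by (subst finprod_insert) (auto simp: h_carrier)
  also have "(\<Otimes>\<^bsub>V\<^esub>i\<in>{..<k}. h (\<alpha> (?K i))) = f"
    unfolding f by (rule finprod_cong') (auto simp: h_carrier)
  also have "h (\<alpha> H) \<otimes>\<^bsub>V\<^esub> f = f \<otimes>\<^bsub>V\<^esub> h (\<alpha> H)"
    using assms(1) heaviside_products_carrier h_carrier by (intro m_comm) auto
  finally have "f \<otimes>\<^bsub>V\<^esub> h (\<alpha> H) = (\<Otimes>\<^bsub>V\<^esub>i\<in>{..<Suc k}. h (\<alpha> (?K i)))" ..
  moreover have "?K \<in> {..<Suc k} \<rightarrow> A" using k(2) assms(2) by (auto simp: less_Suc_eq)
  ultimately show ?thesis unfolding heaviside_products_def using k(1) by blast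
qed

lemma one_in_heaviside_products: "\<one>\<^bsub>V\<^esub> \<in> heaviside_products p"
proof -
  have "\<one>\<^bsub>V\<^esub> = (\<Otimes>\<^bsub>V\<^esub>i\<in>{..<0::nat}. h (\<alpha> (undefined i)))" by simp
  then show ?thesis unfolding heaviside_products_def by blast
qed

lemma heaviside_products_1:
  "heaviside_products (Suc 0) = insert \<one>\<^bsub>V\<^esub> {h (\<alpha> H) | H. H \<in> A}" (is "_ = ?S")
proof
  show "heaviside_products (Suc 0) \<subseteq> ?S"
  proof
    fix f assume "f \<in> heaviside_products (Suc 0)"
    then obtain k H where k: "k \<le> Suc 0" "H \<in> {..<k} \<rightarrow> A"
      and f: "f = (\<Otimes>\<^bsub>V\<^esub>i\<in>{..<k}. h (\<alpha> (H i)))"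
      by (auto simp: heaviside_products_def)
    show "f \<in> ?S"
    proof (cases k)
      case 0
      then show ?thesis by (simp add: f)
    next
      case (Suc m)
      then have "k = Suc 0" using k by simp
      then have "f = h (\<alpha> (H 0))" "H 0 \<in> A" using k f by (auto simp: lessThan_Suc h_carrier)
      then show ?thesis by blast
    qed
  qed
  have "h (\<alpha> H) \<in> heaviside_products (Suc 0)" if "H \<in> A" for H
    using heaviside_product_times_heaviside[OF one_in_heaviside_products[of 0] that]
    by (simp add: h_carrier)
  then show "?S \<subseteq> heaviside_products (Suc 0)" using one_in_heaviside_products by auto
qed

text \<open>Multiplying by a single generator only lengthens a product by one factor; the general case
  follows by bilinearity, one argument at a time. Iterating it bounds the degree of a product of
  elements of the first filtered piece by the number of factors.\<close>

lemma F_times_F1: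
  assumes "f \<in> F p" "g \<in> F (Suc 0)"
  shows "f \<otimes>\<^bsub>V\<^esub> g \<in> F (Suc p)"
proof -
  note car = F_carrier[THEN subsetD] h_carrier
  have *: "F p \<subseteq> {f \<in> carrier V. f \<otimes>\<^bsub>V\<^esub> h (\<alpha> H) \<in> F (Suc p)}" if "H \<in> A" for H
    unfolding F_eq[of p]
  proof (rule lin_span_least)
    show "heaviside_products p \<subseteq> {f \<in> carrier V. f \<otimes>\<^bsub>V\<^esub> h (\<alpha> H) \<in> F (Suc p)}"
      using heaviside_products_carrier heaviside_product_times_heaviside[OF _ that] F_base by blast
  qed (auto simp: h_carrier l_distr smult_assoc2 intro: F_zero F_add F_smult)
  have "F (Suc 0) \<subseteq> {g \<in> carrier V. \<forall>f\<in>F p. f \<otimes>\<^bsub>V\<^esub> g \<in> F (Suc p)}"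
    unfolding F_eq[of "Suc 0"]
  proof (rule lin_span_least)
    show "heaviside_products (Suc 0) \<subseteq> {g \<in> carrier V. \<forall>f\<in>F p. f \<otimes>\<^bsub>V\<^esub> g \<in> F (Suc p)}"
      using * F_mono[of p "Suc p"] car by (auto simp: heaviside_products_1)
  next
    fix r g assume r: "r \<in> carrier R" and g: "g \<in> {g \<in> carrier V. \<forall>f\<in>F p. f \<otimes>\<^bsub>V\<^esub> g \<in> F (Suc p)}"
    have "f \<otimes>\<^bsub>V\<^esub> (r \<odot>\<^bsub>V\<^esub> g) = r \<odot>\<^bsub>V\<^esub> (f \<otimes>\<^bsub>V\<^esub> g)" if "f \<in> F p" for f
      using r g car(1)[OF that] by (simp add: m_comm[of f] smult_assoc2)
    with r g show "r \<odot>\<^bsub>V\<^esub> g \<in> {g \<in> carrier V. \<forall>f\<in>F p. f \<otimes>\<^bsub>V\<^esub> g \<in> F (Suc p)}"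
      by (auto intro: F_smult)
  qed (use car(1) in \<open>auto simp: r_distr intro: F_zero F_add\<close>)
  with assms show ?thesis by blast
qed

text \<open>The first filtered piece does not depend on the chosen defining forms: a positive multiple of
  the chosen form has the same Heaviside function, and a negative multiple has the complementary
  one. This makes it possible to work with whichever multiple of a form is convenient.\<close>

lemma heaviside_in_F1:
  assumes "defining_form \<phi> H" "H \<in> A"
  shows "h \<phi> \<in> F (Suc 0)"
proof -
  have \<alpha>: "defining_form (\<alpha> H) H" using forms assms(2) by (simp add: defining_forms_def)
  obtain c where c: "c \<noteq> 0" "\<And>x. \<phi> x = c * \<alpha> H x"
    using defining_form_unique_up_to_scalar[OF \<alpha> assms(1)] by blast
  have \<alpha>F: "h (\<alpha> H) \<in> F (Suc 0)" and oneF: "\<one>\<^bsub>V\<^esub> \<in> F (Suc 0)"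
    using assms(2) by (auto simp: heaviside_products_1 intro!: F_base)
  have "h \<phi> = (if c > 0 then h (\<alpha> H) else \<one>\<^bsub>V\<^esub> \<ominus>\<^bsub>V\<^esub> h (\<alpha> H))"
  proof (cases "c > 0")
    case True
    then show ?thesis by (simp add: heaviside_def c(2) zero_less_mult_iff)
  next
    case False
    have "h \<phi> \<oplus>\<^bsub>V\<^esub> h (\<alpha> H) = \<one>\<^bsub>V\<^esub>"
    proof (rule carrier_VG_eqI[where R = R])
      fix C assume C: "C \<in> chambers A"
      then obtain x where x: "x \<in> C" using in_components_nonempty by (auto simp: chambers_def)
      have "\<alpha> H x \<noteq> 0" using defining_form_nonzero[OF \<alpha> assms(2) C x] .
      then have "\<phi> x > 0 \<longleftrightarrow> \<not> \<alpha> H x > 0"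
        using c False by (auto simp: zero_less_mult_iff)
      then show "(h \<phi> \<oplus>\<^bsub>V\<^esub> h (\<alpha> H)) C = \<one>\<^bsub>V\<^esub> C"
        using C by (simp add: VG_def heaviside_at[OF assms C x] heaviside_at[OF \<alpha> assms(2) C x])
    qed (simp_all add: h_carrier)
    then have "h \<phi> = \<one>\<^bsub>V\<^esub> \<ominus>\<^bsub>V\<^esub> h (\<alpha> H)"
      by (metis M.add.inv_solve_right h_carrier one_closed a_minus_def)
    with False show ?thesis by simp
  qed
  with \<alpha>F oneF show ?thesis by (simp add: F_minus)
qed

end

section \<open>Coordinatewise inversion and chambers\<close>

text \<open>This is the part of the relation between an arrangement and its Cremona transform that is needed
  to map the complement of \<open>A\<close> into that of \<open>B\<close>. It asks that every
  non-coordinate hyperplane of \<open>B\<close> have some two-term equation that comes from \<open>A\<close>.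
  Requiring it in both directions gives a
  symmetric relation without having to show that the Cremona transform is an involution on
  arrangements, that is, that two-term equations are unique up to scaling and order.\<close>

definition cremona_dominates :: "(real^'n::finite) set set \<Rightarrow> (real^'n) set set \<Rightarrow> bool" where
  "cremona_dominates A B \<longleftrightarrow> range coord_hyperplane \<subseteq> A \<and>
    (\<forall>H\<in>B. H \<in> range coord_hyperplane \<or>
      (\<exists>a i b j. i \<noteq> j \<and> a \<noteq> 0 \<and> b \<noteq> 0 \<and> H = {X. two_term_form b i a j X = 0} \<and>
        {x. two_term_form a i b j x = 0} \<in> A))"

definition cremona_pair :: "(real^'n::finite) set set \<Rightarrow> (real^'n) set set \<Rightarrow> bool" where
  "cremona_pair A B \<longleftrightarrow> cremona_dominates A B \<and> cremona_dominates B A"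

lemma cremona_pair_sym: "cremona_pair A B \<Longrightarrow> cremona_pair B A"
  by (simp add: cremona_pair_def)

lemma cremona_dominates_cases:
  assumes "cremona_dominates A B" "H \<in> B"
  obtains (coord) i where "H = coord_hyperplane i"
  | (two_term) a i b j where "i \<noteq> j" "a \<noteq> 0" "b \<noteq> 0" "H = {X. two_term_form b i a j X = 0}"
      "{x. two_term_form a i b j x = 0} \<in> A"
proof -
  from assms have "H \<in> range coord_hyperplane \<or>
      (\<exists>a i b j. i \<noteq> j \<and> a \<noteq> 0 \<and> b \<noteq> 0 \<and> H = {X. two_term_form b i a j X = 0} \<and>
        {x. two_term_form a i b j x = 0} \<in> A)"
    by (simp add: cremona_dominates_def)
  then show thesis using that by (elim disjE imageE exE conjE) simp_all
qed

lemma cremona_pair_cremona: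
  assumes coord: "\<And>i. coord_hyperplane i \<in> A"
    and two_term: "\<And>H. H \<in> A \<Longrightarrow> H \<notin> range coord_hyperplane \<Longrightarrow>
      \<exists>a i b j. i \<noteq> j \<and> a \<noteq> 0 \<and> b \<noteq> 0 \<and> defining_form (two_term_form a i b j) H"
  shows "cremona_pair A (cremona A)"
proof -
  have "cremona_dominates A (cremona A)"
    using coord unfolding cremona_dominates_def cremona_def by blast
  moreover have "\<exists>a i b j. i \<noteq> j \<and> a \<noteq> 0 \<and> b \<noteq> 0 \<and> H = {X. two_term_form b i a j X = 0} \<and>
      {x. two_term_form a i b j x = 0} \<in> cremona A" if H: "H \<in> A" "H \<notin> range coord_hyperplane" for H
  proof -
    obtain a i b j where "i \<noteq> j" "a \<noteq> 0" "b \<noteq> 0" "H = {x. two_term_form a i b j x = 0}"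
      using two_term[OF H] by (auto simp: defining_form_def)
    moreover from this H(1) have "{X. two_term_form b i a j X = 0} \<in> cremona A"
      unfolding cremona_def by blast
    ultimately show ?thesis by blast
  qed
  then have "cremona_dominates (cremona A) A"
    unfolding cremona_dominates_def by (auto simp: cremona_def)
  ultimately show ?thesis by (simp add: cremona_pair_def)
qed

lemma kappa_nth [simp]: "kappa x $ i = inverse (x $ i)"
  by (simp add: kappa_def)

lemma kappa_kappa [simp]: "kappa (kappa x) = x"
  by (simp add: kappa_def vec_eq_iff)

lemma arr_complement_nth_nonzero:
  assumes "range coord_hyperplane \<subseteq> A" "x \<in> arr_complement A"
  shows "x $ i \<noteq> 0"
proof -
  have "x \<notin> coord_hyperplane i" using assms by (auto simp: arr_complement_def)
  then show ?thesis by (simp add: coord_hyperplane_def)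
qed

lemma two_term_form_kappa:
  assumes "x $ i \<noteq> 0" "x $ j \<noteq> 0"
  shows "two_term_form b i a j (kappa x) = two_term_form a i b j x / (x $ i * x $ j)"
  using assms by (simp add: two_term_form_def field_simps)

lemma kappa_arr_complement:
  assumes "cremona_dominates A B" "x \<in> arr_complement A"
  shows "kappa x \<in> arr_complement B"
proof -
  have nz: "x $ i \<noteq> 0" for i
    using assms arr_complement_nth_nonzero by (auto simp: cremona_dominates_def)
  have "kappa x \<notin> H" if "H \<in> B" for H
    using assms(1) that
  proof (cases rule: cremona_dominates_cases)
    case (coord i)
    then show ?thesis using nz by (simp add: coord_hyperplane_def)
  next
    case (two_term a i b j)
    have "two_term_form a i b j x \<noteq> 0"
      using two_term(5) assms(2) by (auto simp: arr_complement_def)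
    then show ?thesis using two_term(4) nz by (simp add: two_term_form_kappa)
  qed
  then show ?thesis by (auto simp: arr_complement_def)
qed

lemma homeomorphism_kappa:
  assumes "cremona_pair A B"
  shows "homeomorphism (arr_complement A) (arr_complement B) kappa kappa"
proof -
  have cont: "continuous_on (arr_complement A) kappa"
    if "cremona_dominates A B" for A B :: "(real^'n) set set"
  proof -
    have "x $ i \<noteq> 0" if "x \<in> arr_complement A" for x i
      using that \<open>cremona_dominates A B\<close> arr_complement_nth_nonzero
      by (auto simp: cremona_dominates_def)
    then show ?thesis unfolding kappa_def
      by (auto intro!: continuous_intros)
  qed
  show ?thesis
    using assms unfolding cremona_pair_def
    by (intro homeomorphismI cont) (auto intro: kappa_arr_complement cont)
qed

lemma kappa_chamber:
  assumes "cremona_pair A B" "C \<in> chambers A"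
  shows "kappa ` C \<in> chambers B"
proof -
  note hom = homeomorphism_kappa[OF assms(1)]
  obtain x where x: "x \<in> arr_complement A" "C = connected_component_set (arr_complement A) x"
    using assms(2) by (auto simp: chambers_def components_def)
  have "kappa ` C = connected_component_set (arr_complement B) (kappa x)"
    unfolding x(2) by (rule connected_component_set_homeomorphism[OF hom x(1), symmetric])
  moreover have "kappa x \<in> arr_complement B"
    using hom x(1) by (auto simp: homeomorphism_def)
  ultimately show ?thesis by (auto simp: chambers_def components_def)
qed

lemma kappa_image_kappa_image [simp]: "kappa ` kappa ` C = C"
  by (simp add: image_image)

lemma bij_betw_chambers:
  assumes "cremona_pair A B"
  shows "bij_betw (\<lambda>C. kappa ` C) (chambers A) (chambers B)"
  using kappa_chamber[OF assms] kappa_chamber[OF cremona_pair_sym[OF assms]]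
  by (intro bij_betw_byWitness[where f' = "\<lambda>C. kappa ` C"]) auto

section \<open>Pullback along inversion\<close>

lemma kappa_pullback_carrier:
  assumes "cremona_pair A B" "f \<in> carrier (VG R B)"
  shows "kappa_pullback A f \<in> carrier (VG R A)"
  using assms kappa_chamber by (fastforce simp: kappa_pullback_def VG_def)

lemma kappa_pullback_pullback:
  assumes "cremona_pair A B" "f \<in> carrier (VG R B)"
  shows "kappa_pullback B (kappa_pullback A f) = f"
proof (rule carrier_VG_eqI)
  show "kappa_pullback B (kappa_pullback A f) \<in> carrier (VG R B)"
    using assms by (intro kappa_pullback_carrier[OF cremona_pair_sym[of A B]] kappa_pullback_carrier)
  show "kappa_pullback B (kappa_pullback A f) C = f C" if "C \<in> chambers B" for C
    using that kappa_chamber[OF cremona_pair_sym[OF assms(1)] that] by (simp add: kappa_pullback_def)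
qed fact

lemma kappa_pullback_ops:
  assumes "cremona_pair A B"
  shows kappa_pullback_one: "kappa_pullback A \<one>\<^bsub>VG R B\<^esub> = \<one>\<^bsub>VG R A\<^esub>"
    and kappa_pullback_zero: "kappa_pullback A \<zero>\<^bsub>VG R B\<^esub> = \<zero>\<^bsub>VG R A\<^esub>"
    and kappa_pullback_mult:
      "kappa_pullback A (f \<otimes>\<^bsub>VG R B\<^esub> g) = kappa_pullback A f \<otimes>\<^bsub>VG R A\<^esub> kappa_pullback A g"
    and kappa_pullback_add:
      "kappa_pullback A (f \<oplus>\<^bsub>VG R B\<^esub> g) = kappa_pullback A f \<oplus>\<^bsub>VG R A\<^esub> kappa_pullback A g"
    and kappa_pullback_smult:
      "kappa_pullback A (r \<odot>\<^bsub>VG R B\<^esub> f) = r \<odot>\<^bsub>VG R A\<^esub> kappa_pullback A f"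
  using kappa_chamber[OF assms] by (auto simp: VG_def kappa_pullback_def)

lemma kappa_pullback_alg_iso:
  assumes "cremona_pair A B"
  shows "kappa_pullback A \<in> alg_iso R (VG R B) (VG R A)"
proof -
  note ops = kappa_pullback_ops[OF assms]
  have "bij_betw (kappa_pullback A) (carrier (VG R B)) (carrier (VG R A))"
    using kappa_pullback_carrier[OF assms] kappa_pullback_carrier[OF cremona_pair_sym[OF assms]]
      kappa_pullback_pullback[OF assms] kappa_pullback_pullback[OF cremona_pair_sym[OF assms]]
    by (intro bij_betw_byWitness[where f' = "kappa_pullback B"]) auto
  then show ?thesis
    by (auto simp: alg_iso_def ops intro!: ring_iso_memI kappa_pullback_carrier[OF assms]
        dest: bij_betwE)
qed

lemma kappa_pullback_heaviside_at:
  assumes "cremona_pair A B" "defining_form \<psi> H" "H \<in> B" "C \<in> chambers A" "x \<in> C"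
  shows "kappa_pullback A (heaviside R B \<psi>) C = (if \<psi> (kappa x) > 0 then \<one>\<^bsub>R\<^esub> else \<zero>\<^bsub>R\<^esub>)"
proof -
  have "kappa x \<in> kappa ` C" using assms(5) by simp
  then show ?thesis
    using assms(4) by (simp add: kappa_pullback_def
        heaviside_at[OF assms(2,3) kappa_chamber[OF assms(1,4)], of "kappa x"])
qed

text \<open>The right-hand side says that \<open>[u > 0] + [v > 0] - [u + v > 0]\<close> equals 1: with both signs
  positive it is \<open>2 - 1\<close>, with both negative \<open>0\<close>, and with opposite signs
  \<open>1 - [u + v > 0]\<close>.\<close>

lemma inverse_add_inverse_pos_iff:
  fixes u v :: real
  assumes "u \<noteq> 0" "v \<noteq> 0" "u + v \<noteq> 0"
  shows "inverse u + inverse v > 0 \<longleftrightarrow> (u > 0 \<and> v > 0) \<or> ((u > 0 \<or> v > 0) \<and> \<not> u + v > 0)"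
proof -
  have "inverse u + inverse v = (u + v) / (u * v)" using assms by (simp add: field_simps)
  then show ?thesis using assms by (auto simp: zero_less_divide_iff zero_less_mult_iff mult_less_0_iff)
qed

text \<open>The filtration degree does not go up under pullback. For a coordinate hyperplane, \<open>x\<^sub>i\<close> and its inverse
  have the same sign. For a two-term form, the linear dependence of \<open>u\<close>, \<open>v\<close> and \<open>w = u + v\<close>
  turns the product of three signs into a sum of Heaviside functions.\<close>

lemma kappa_pullback_heaviside_in_F1:
  assumes "cring R" "defining_forms A \<alpha>"
    and pair: "cremona_pair A B" and \<psi>: "defining_form \<psi> H" and H: "H \<in> B"
  shows "kappa_pullback A (heaviside R B \<psi>) \<in> VG_filt R A \<alpha> (Suc 0)"
proof -
  interpret VG_filtered R A \<alpha> using assms(1,2) by (rule VG_filtered.intro)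
  have dom: "cremona_dominates A B" and coordA: "\<And>i. coord_hyperplane i \<in> A"
    using pair by (auto simp: cremona_pair_def cremona_dominates_def)
  have coordF: "defining_form (\<lambda>x. d * x $ i) (coord_hyperplane i)" if "d \<noteq> 0" for d i
    by (rule defining_form_scale[OF defining_form_coord that])
  note pull = kappa_pullback_heaviside_at[OF pair \<psi> H]
  have pull_carrier: "kappa_pullback A (heaviside R B \<psi>) \<in> carrier V"
    by (rule kappa_pullback_carrier[OF pair heaviside_carrier[OF cring_R]])
  show ?thesis using dom H
  proof (cases rule: cremona_dominates_cases)
    case (coord i)
    obtain c where c: "c \<noteq> 0" "\<And>X. \<psi> X = c * X $ i"
      using defining_form_unique_up_to_scalar[OF defining_form_coord \<psi>[unfolded coord]] by blast
    have "kappa_pullback A (heaviside R B \<psi>) = h (\<lambda>x. c * x $ i)"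
    proof (rule carrier_VG_eqI[OF pull_carrier h_carrier])
      fix C assume C: "C \<in> chambers A"
      then obtain x where x: "x \<in> C" using in_components_nonempty by (auto simp: chambers_def)
      have "c * inverse (x $ i) > 0 \<longleftrightarrow> c * x $ i > 0"
        by (simp add: zero_less_mult_iff)
      then show "kappa_pullback A (heaviside R B \<psi>) C = h (\<lambda>x. c * x $ i) C"
        by (simp add: pull[OF C x] heaviside_at[OF coordF[OF c(1)] coordA C x] c(2))
    qed
    then show ?thesis using heaviside_in_F1[OF coordF[OF c(1)] coordA] by simp
  next
    case (two_term a i b j)
    obtain c where c: "c \<noteq> 0" "\<And>X. \<psi> X = c * two_term_form b i a j X"
      using defining_form_unique_up_to_scalar[OF defining_form_two_term \<psi>[unfolded two_term(4)]]
        two_term(1,3) by blast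
    \<comment> \<open>With this scaling, \<open>\<psi> (kappa x)\<close> is a positive multiple of \<open>1/u + 1/v\<close>, whatever
      the signs of \<open>a\<close>, \<open>b\<close> and \<open>c\<close> are.\<close>
    define d where "d = c * a * b"
    have nz: "d \<noteq> 0" "d * a \<noteq> 0" "d * b \<noteq> 0" using c(1) two_term(2,3) by (auto simp: d_def)
    let ?u = "\<lambda>x::real^_. d * a * x $ i" and ?v = "\<lambda>x::real^_. d * b * x $ j"
    let ?w = "\<lambda>x::real^_. d * two_term_form a i b j x"
    note u = coordF[OF nz(2)] and v = coordF[OF nz(3)]
      and w = defining_form_scale[OF defining_form_two_term[OF two_term(1,2)] nz(1)]
    note wA = two_term(5)
    have w_eq: "?w x = ?u x + ?v x" for x by (simp add: two_term_form_def algebra_simps)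
    have F1: "h ?u \<in> F (Suc 0)" "h ?v \<in> F (Suc 0)" "h ?w \<in> F (Suc 0)"
      using heaviside_in_F1[OF u coordA] heaviside_in_F1[OF v coordA] heaviside_in_F1[OF w wA] .
    \<comment> \<open>With the subtracted term on the left, only 0 and 1 are added and the identity
      can be checked sign pattern by sign pattern.\<close>
    have "kappa_pullback A (heaviside R B \<psi>) \<oplus>\<^bsub>V\<^esub> h ?w = h ?u \<oplus>\<^bsub>V\<^esub> h ?v"
    proof (rule carrier_VG_eqI[where R = R])
      fix C assume C: "C \<in> chambers A"
      then obtain x where x: "x \<in> C" using in_components_nonempty by (auto simp: chambers_def)
      have unz: "?u x \<noteq> 0" and vnz: "?v x \<noteq> 0" and wnz: "?w x \<noteq> 0"
        using defining_form_nonzero[OF u coordA C x] defining_form_nonzero[OF v coordA C x]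
          defining_form_nonzero[OF w wA C x] .
      have "\<psi> (kappa x) = d\<^sup>2 * (inverse (?u x) + inverse (?v x))"
        using unz vnz by (simp add: c(2) d_def two_term_form_def power2_eq_square field_simps)
      then have "\<psi> (kappa x) > 0 \<longleftrightarrow> inverse (?u x) + inverse (?v x) > 0"
        using nz(1) by (simp add: zero_less_mult_iff)
      then have pos: "\<psi> (kappa x) > 0 \<longleftrightarrow>
          (?u x > 0 \<and> ?v x > 0) \<or> ((?u x > 0 \<or> ?v x > 0) \<and> \<not> ?w x > 0)"
        using inverse_add_inverse_pos_iff[OF unz vnz] wnz by (simp add: w_eq)
      have w_pos: "?u x > 0 \<Longrightarrow> ?v x > 0 \<Longrightarrow> ?w x > 0"
        and w_neg: "\<not> ?u x > 0 \<Longrightarrow> \<not> ?v x > 0 \<Longrightarrow> \<not> ?w x > 0"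
        unfolding w_eq by linarith+
      have at: "(f \<oplus>\<^bsub>V\<^esub> g) C = f C \<oplus>\<^bsub>R\<^esub> g C" for f g using C by (simp add: VG_def)
      show "(kappa_pullback A (heaviside R B \<psi>) \<oplus>\<^bsub>V\<^esub> h ?w) C = (h ?u \<oplus>\<^bsub>V\<^esub> h ?v) C"
        unfolding at pull[OF C x] heaviside_at[OF u coordA C x] heaviside_at[OF v coordA C x]
          heaviside_at[OF w wA C x]
        using pos w_pos w_neg
        by (cases "?u x > 0"; cases "?v x > 0"; cases "?w x > 0") simp_all
    qed (simp_all add: h_carrier pull_carrier)
    then have "kappa_pullback A (heaviside R B \<psi>) = (h ?u \<oplus>\<^bsub>V\<^esub> h ?v) \<ominus>\<^bsub>V\<^esub> h ?w"
      using pull_carrier h_carrier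
      by (metis M.add.inv_solve_right M.add.m_closed a_minus_def)
    then show ?thesis using F1 by (simp add: F_minus F_add)
  qed
qed

lemma kappa_pullback_filt_subset:
  assumes "cring R" "cremona_pair A B" "defining_forms A \<alpha>" "defining_forms B \<beta>"
  shows "kappa_pullback A ` VG_filt R B \<beta> p \<subseteq> VG_filt R A \<alpha> p"
proof -
  interpret A: VG_filtered R A \<alpha> using assms(1,3) by (rule VG_filtered.intro)
  interpret B: VG_filtered R B \<beta> using assms(1,4) by (rule VG_filtered.intro)
  note ops = kappa_pullback_ops[OF assms(2)]
  have gen: "kappa_pullback A (\<Otimes>\<^bsub>B.V\<^esub>i\<in>{..<k}. B.h (\<beta> (H i))) \<in> A.F k"
    if "H \<in> {..<k} \<rightarrow> B" for k and H :: "nat \<Rightarrow> _"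
    using that
  proof (induction k)
    case 0
    then show ?case by (simp add: ops A.F_base A.one_in_heaviside_products)
  next
    case (Suc k)
    have "defining_form (\<beta> (H k)) (H k)" "H k \<in> B"
      using Suc.prems assms(4) by (auto simp: defining_forms_def)
    then have 1: "kappa_pullback A (B.h (\<beta> (H k))) \<in> A.F (Suc 0)"
      by (rule kappa_pullback_heaviside_in_F1[OF assms(1,3,2)])
    have 2: "kappa_pullback A (\<Otimes>\<^bsub>B.V\<^esub>i\<in>{..<k}. B.h (\<beta> (H i))) \<in> A.F k"
      using Suc.prems by (intro Suc.IH) auto
    have "(\<Otimes>\<^bsub>B.V\<^esub>i\<in>{..<Suc k}. B.h (\<beta> (H i)))
        = B.h (\<beta> (H k)) \<otimes>\<^bsub>B.V\<^esub> (\<Otimes>\<^bsub>B.V\<^esub>i\<in>{..<k}. B.h (\<beta> (H i)))"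
      unfolding lessThan_Suc by (subst B.finprod_insert) (auto simp: B.h_carrier)
    also have "\<dots> = (\<Otimes>\<^bsub>B.V\<^esub>i\<in>{..<k}. B.h (\<beta> (H i))) \<otimes>\<^bsub>B.V\<^esub> B.h (\<beta> (H k))"
      by (intro B.m_comm B.finprod_closed) (auto simp: B.h_carrier)
    finally show ?case using A.F_times_F1[OF 2 1] by (simp add: ops)
  qed
  have "B.F p \<subseteq> {f \<in> carrier B.V. kappa_pullback A f \<in> A.F p}"
    unfolding B.F_eq
  proof (rule B.lin_span_least)
    show "B.heaviside_products p \<subseteq> {f \<in> carrier B.V. kappa_pullback A f \<in> A.F p}"
      using gen A.F_mono[of _ p] B.heaviside_products_carrier[of p]
      unfolding B.heaviside_products_def by blast
  qed (auto simp: ops intro: A.F_zero A.F_add A.F_smult)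
  then show ?thesis by blast
qed

text \<open>The second inclusion is the first one for the exchanged pair, as pulling back twice is the
  identity.\<close>

lemma kappa_pullback_filt:
  assumes "cring R" "cremona_pair A B" "defining_forms A \<alpha>" "defining_forms B \<beta>"
  shows "kappa_pullback A ` VG_filt R B \<beta> p = VG_filt R A \<alpha> p"
proof
  interpret A: VG_filtered R A \<alpha> using assms(1,3) by (rule VG_filtered.intro)
  show "kappa_pullback A ` VG_filt R B \<beta> p \<subseteq> VG_filt R A \<alpha> p"
    by (rule kappa_pullback_filt_subset[OF assms])
  show "VG_filt R A \<alpha> p \<subseteq> kappa_pullback A ` VG_filt R B \<beta> p"
  proof
    fix f assume f: "f \<in> VG_filt R A \<alpha> p"
    note sym = cremona_pair_sym[OF assms(2)]
    have "kappa_pullback B f \<in> VG_filt R B \<beta> p"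
      using kappa_pullback_filt_subset[OF assms(1) sym assms(4,3)] f by blast
    moreover have "kappa_pullback A (kappa_pullback B f) = f"
      using kappa_pullback_pullback[OF sym] A.F_carrier f by blast
    ultimately show "f \<in> kappa_pullback A ` VG_filt R B \<beta> p" by (metis image_eqI)
  qed
qed

theorem theorem2p1:
  fixes R :: "('r, 'm) ring_scheme"
    and A :: "(real^'n::finite) set set"
    and \<alpha> \<beta> :: "(real^'n) set \<Rightarrow> real^'n \<Rightarrow> real"
  assumes "cring R"
    and "central_arrangement A"
    and "\<And>i. coord_hyperplane i \<in> A"
    and "\<And>H. H \<in> A \<Longrightarrow> H \<notin> range coord_hyperplane \<Longrightarrow>
           \<exists>a i b j. i \<noteq> j \<and> a \<noteq> 0 \<and> b \<noteq> 0 \<and> defining_form (two_term_form a i b j) H"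
    and "defining_forms A \<alpha>"
    and "defining_forms (cremona A) \<beta>"
  shows "bij_betw (\<lambda>C. kappa ` C) (chambers A) (chambers (cremona A)) \<and>
    kappa_pullback A \<in> filtered_alg_iso R
      (VG R (cremona A)) (VG_filt R (cremona A) \<beta>)
      (VG R A) (VG_filt R A \<alpha>)"
proof -
  have pair: "cremona_pair A (cremona A)"
    by (rule cremona_pair_cremona[OF assms(3,4)])
  show ?thesis
    using bij_betw_chambers[OF pair] kappa_pullback_alg_iso[OF pair]
      kappa_pullback_filt[OF assms(1) pair assms(5,6)]
    by (simp add: filtered_alg_iso_def)
qed

end
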